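(* The minimum number of disjoint monochromatic triangles in a $2$-coloring of the edges of a complete graph on $n$ vertices is $$\left\lfloor \frac{n-2}{3}\right\rfloor.$$ That is, the minimum, over all red-blue colorings of the edges of the complete graph $K_n$, of the maximum number of pairwise vertex-disjoint monochromatic triangles in the coloring equals $\left\lfloor \frac{n-2}{3}\right\rfloor$.
   Context: $K_n$ denotes the complete graph on $n$ vertices. A $2$-coloring assigns to each edge one of the colors red, blue. A triangle is monochromatic if its three edges have the same color. Two triangles are disjoint if they share no vertex; different triangles in a disjoint family may have different colors.
   Formalization: The formula is proved for every n ≥ 2 except n = 5; it fails for n = 0 and 1, where it gives −1, and for n = 5, where it gives 1 but colouring a 5-cycle red and the other edges blue leaves no monochromatic triangle. *)

theory Defs
  imports "HOL-Library.Ramsey" "HOL-Library.FuncSet"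
begin

datatype colour = Red | Blue

text \<open>
  The complete graph on a vertex set \<open>V\<close> has edge set \<open>nsets V 2\<close>, the two-element subsets
  of \<open>V\<close>. Colourings are extensional, so that they are determined by the colours of the edges.
\<close>

definition colourings :: "'a set \<Rightarrow> ('a set \<Rightarrow> colour) set" where
  "colourings V = nsets V 2 \<rightarrow>\<^sub>E UNIV"

definition mono_triangle :: "'a set \<Rightarrow> ('a set \<Rightarrow> colour) \<Rightarrow> 'a set \<Rightarrow> bool" where
  "mono_triangle V c T \<longleftrightarrow> T \<in> nsets V 3 \<and> (\<exists>k. \<forall>e\<in>nsets T 2. c e = k)"

definition disjoint_mono_families :: "'a set \<Rightarrow> ('a set \<Rightarrow> colour) \<Rightarrow> 'a set set set" where
  "disjoint_mono_families V c = {F. (\<forall>T\<in>F. mono_triangle V c T) \<and> pairwise disjnt F}"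

definition max_disjoint_mono :: "'a set \<Rightarrow> ('a set \<Rightarrow> colour) \<Rightarrow> nat" where
  "max_disjoint_mono V c = Max (card ` disjoint_mono_families V c)"

definition min_disjoint_mono :: "'a set \<Rightarrow> nat" where
  "min_disjoint_mono V = Min (max_disjoint_mono V ` colourings V)"

text \<open>For finite \<open>V\<close>, the sets under \<^const>\<open>Max\<close> and \<^const>\<open>Min\<close> are finite and nonempty.\<close>

lemma finite_disjoint_mono_families:
  assumes "finite V"
  shows "finite (disjoint_mono_families V c)"
proof (rule finite_subset)
  show "disjoint_mono_families V c \<subseteq> Pow (Pow V)"
    by (auto simp: disjoint_mono_families_def mono_triangle_def nsets_def)
qed (use assms in simp)

lemma disjoint_mono_families_nonempty: "disjoint_mono_families V c \<noteq> {}"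
proof -
  have "{} \<in> disjoint_mono_families V c"
    by (simp add: disjoint_mono_families_def)
  then show ?thesis by blast
qed

lemma finite_colourings:
  assumes "finite V"
  shows "finite (colourings V)"
proof -
  have "(UNIV :: colour set) = {Red, Blue}"
    using colour.exhaust by blast
  then have "finite (UNIV :: colour set)"
    by (metis finite.emptyI finite.insertI)
  then show ?thesis
    unfolding colourings_def using assms by (intro finite_PiE finite_imp_finite_nsets)
qed

lemma colourings_nonempty: "colourings V \<noteq> {}"
  by (simp add: colourings_def PiE_eq_empty_iff)

end

theory Submission
  imports Defs
begin

text \<open>
  The heart of the matter is that \<open>K\<^sub>8\<close> contains two disjoint monochromatic triangles; for larger
  \<open>n\<close>, remove triangles one at a time, three vertices each, until eight to ten vertices are left.

  If \<open>K\<^sub>8\<close> had no two, then deleting any monochromatic triangle would leave a \<open>K\<^sub>5\<close> without one.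
  Such a \<open>K\<^sub>5\<close> splits into a red and a blue pentagon, so none of its vertices has three edges of
  one colour. Let \<open>abc\<close> be red and let \<open>p, q, r, s, t\<close> be the red pentagon that is left. If \<open>a\<close> is
  joined in red to two neighbours on the pentagon, or in blue to two non-neighbours, this is
  another monochromatic triangle, and comparing the \<open>K\<^sub>5\<close>s left by the triangles found so far gives a
  contradiction. But \<open>a\<close> must do one or the other: otherwise at most two of its five edges to the
  pentagon are red, and at most two are blue.
\<close>

section \<open>Monochromatic triangles\<close>

lemma colour_eq_iff: "c = d \<longleftrightarrow> (c = k \<longleftrightarrow> d = k)" for c d k :: colour
  by (cases c; cases d; cases k) auto

lemma mono_triangle_triple:
  assumes "distinct [x, y, z]"
  shows "mono_triangle V c {x, y, z} \<longleftrightarrow>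
    {x, y, z} \<subseteq> V \<and> c {x, y} = c {x, z} \<and> c {x, z} = c {y, z}"
proof -
  have "nsets {x, y, z} 2 = {{x, y}, {x, z}, {y, z}}"
  proof -
    have "nsets {x, y, z} 2 \<subseteq> {{x, y}, {x, z}, {y, z}}"
      by (auto simp: nsets_def card_2_iff doubleton_eq_iff)
    moreover have "{{x, y}, {x, z}, {y, z}} \<subseteq> nsets {x, y, z} 2"
      using assms by (auto simp: nsets_def)
    ultimately show ?thesis by blast
  qed
  moreover have "{x, y, z} \<in> nsets V 3 \<longleftrightarrow> {x, y, z} \<subseteq> V"
    using assms by (simp add: nsets_def)
  ultimately show ?thesis
    unfolding mono_triangle_def by (simp only: ball_simps) metis
qed

lemma mono_triangle_mono: "mono_triangle W c T \<Longrightarrow> W \<subseteq> V \<Longrightarrow> mono_triangle V c T"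
  by (auto simp: mono_triangle_def nsets_def)

lemma mono_triangleD:
  assumes "mono_triangle V c T"
  shows "T \<subseteq> V" "finite T" "card T = 3" "T \<noteq> {}"
  using assms by (auto simp: mono_triangle_def nsets_def)

text \<open>Ramsey's bound R(3,3) \<le> 6: three edges at \<open>v\<close> share a colour; either an
  edge among their ends has it too, or these ends form a monochromatic triangle.\<close>

lemma obtain_mono_triangle:
  assumes "card V \<ge> 6"
  obtains T where "mono_triangle V c T"
proof -
  have fin: "finite V" using assms by (metis card.infinite not_numeral_le_zero)
  obtain v where v: "v \<in> V" using assms by fastforce
  define N where "N k = {w \<in> V - {v}. c {v, w} = k}" for k
  have "V - {v} = N Red \<union> N Blue"
    by (auto simp: N_def intro: colour.exhaust)
  moreover have "card (V - {v}) \<ge> 5" using assms v fin by simp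
  ultimately have "card (N Red) + card (N Blue) \<ge> 5"
    using card_Un_le[of "N Red" "N Blue"] by simp
  then have "card (N Red) \<ge> 3 \<or> card (N Blue) \<ge> 3" by linarith
  then obtain k where "card (N k) \<ge> 3" by blast
  then obtain S where S: "S \<subseteq> N k" "card S = 3" by (metis obtain_subset_with_card_n)
  then obtain x y z where xyz: "S = {x, y, z}" "distinct [x, y, z]"
    by (auto simp: card_3_iff)
  with S have *: "x \<in> V" "y \<in> V" "z \<in> V" "v \<noteq> x" "v \<noteq> y" "v \<noteq> z"
    "c {v, x} = k" "c {v, y} = k" "c {v, z} = k"
    by (auto simp: N_def)
  consider "c {x, y} = k" | "c {x, z} = k" | "c {y, z} = k"
    | "c {x, y} = c {x, z}" "c {x, z} = c {y, z}"
    by (metis colour_eq_iff)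
  then have "mono_triangle V c {v, x, y} \<or> mono_triangle V c {v, x, z} \<or>
    mono_triangle V c {v, y, z} \<or> mono_triangle V c {x, y, z}"
    by cases (use xyz(2) v * in \<open>simp_all add: mono_triangle_triple\<close>)
  then show thesis using that by blast
qed

section \<open>Two disjoint triangles on eight vertices\<close>

text \<open>A Boolean relation replaces the colouring, so that claims about finitely many edges
  become propositional.\<close>

definition mono3 :: "('a \<Rightarrow> 'a \<Rightarrow> bool) \<Rightarrow> 'a \<Rightarrow> 'a \<Rightarrow> 'a \<Rightarrow> bool" where
  "mono3 E x y z \<longleftrightarrow> E x y = E x z \<and> E x z = E y z"

text \<open>\<open>E\<close> is the red graph, where red is the colour of some chosen edge.\<close>

locale no_two_disjoint_mono =
  fixes V :: "'a set" and E :: "'a \<Rightarrow> 'a \<Rightarrow> bool"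
  assumes sym: "E x y \<longleftrightarrow> E y x"
    and not_two: "\<lbrakk>mono3 E x y z; distinct [x, y, z, u, v, w]; {x, y, z, u, v, w} \<subseteq> V\<rbrakk>
      \<Longrightarrow> \<not> mono3 E u v w"
begin

text \<open>With three edges of one colour at \<open>v\<close>, an edge of that colour among
  \<open>p\<close>, \<open>q\<close>, \<open>r\<close> closes a triangle at \<open>v\<close>; if
  there is none, \<open>pqr\<close> is monochromatic. Either triangle avoids
  \<open>xyz\<close>.\<close>

lemma no_star:
  assumes mono: "mono3 E x y z"
    and dist: "distinct [x, y, z, v, p, q, r]" and V: "{x, y, z, v, p, q, r} \<subseteq> V"
  shows "\<not> (E v p = E v q \<and> E v q = E v r)"
proof -
  have "\<not> mono3 E v p q" "\<not> mono3 E v p r" "\<not> mono3 E v q r" "\<not> mono3 E p q r"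
    using not_two[OF mono] dist V by auto
  then show ?thesis unfolding mono3_def by argo
qed

text \<open>By \<open>no_star\<close>, each of the five vertices has exactly two red edges to the
  other four. A 2-regular graph on five vertices is a 5-cycle.\<close>

lemma pentagon:
  assumes mono: "mono3 E x y z"
    and dist: "distinct [x, y, z, a, b, c, d, e]" and V: "{x, y, z, a, b, c, d, e} \<subseteq> V"
  obtains p q r s t where "distinct [x, y, z, p, q, r, s, t]" "{x, y, z, p, q, r, s, t} \<subseteq> V"
    "E p q" "E q r" "E r s" "E s t" "E t p" "\<not> E p r" "\<not> E q s" "\<not> E r t" "\<not> E s p" "\<not> E t q"
proof -
  note cycle = that
  have path: thesis
    if pq: "distinct [x, y, z, p, q, r, s, t]" "{x, y, z, p, q, r, s, t} \<subseteq> V"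
      and E: "E p q" "E p t" "\<not> E p r" "\<not> E p s" "E q r" for p q r s t
  proof -
    have "\<not> mono3 E p q t" "\<not> mono3 E p r s" "\<not> mono3 E q r s" "\<not> mono3 E q s t" "\<not> mono3 E r s t"
      "\<not> (E s p = E s q \<and> E s q = E s t)"
      by (rule not_two[OF mono] no_star[OF mono]; use pq in auto)+
    moreover have "E t p = E p t" "E s p = E p s" "E t q = E q t" "E s q = E q s"
      by (rule sym)+
    ultimately have rest: "E r s" "E s t" "E t p" "\<not> E q s" "\<not> E r t" "\<not> E s p" "\<not> E t q"
      using E unfolding mono3_def by argo+
    show thesis
      by (rule cycle[OF pq E(1,5) rest(1-3) E(3) rest(4-7)])
  qed
  \<comment> \<open>A red \<open>qt\<close> would close the triangle \<open>pqt\<close>, so another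
    red neighbour of \<open>q\<close> is \<open>r\<close> or \<open>s\<close>; exchanging these
    labels leaves one case.\<close>
  have nbrs: thesis
    if pq: "distinct [x, y, z, p, q, r, s, t]" "{x, y, z, p, q, r, s, t} \<subseteq> V"
      and E: "E p q" "E p t" "\<not> E p r" "\<not> E p s" for p q r s t
  proof -
    have "\<not> mono3 E p q t" "\<not> (E q r = E q s \<and> E q s = E q t)"
      by (rule not_two[OF mono] no_star[OF mono]; use pq in auto)+
    then consider "E q r" | "E q s"
      using E unfolding mono3_def by argo
    then show thesis
    proof cases
      case 1
      show thesis by (rule path[OF pq E 1])
    next
      case 2
      show thesis by (rule path[of p q s r t]) (use pq E 2 in auto)
    qed
  qed
  have "\<not> (E a b = E a c \<and> E a c = E a d)" "\<not> (E a b = E a c \<and> E a c = E a e)"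
    "\<not> (E a b = E a d \<and> E a d = E a e)" "\<not> (E a c = E a d \<and> E a d = E a e)"
    by (rule no_star[OF mono]; use dist V in auto)+
  then consider "E a b" "E a c" "\<not> E a d" "\<not> E a e" | "E a b" "E a d" "\<not> E a c" "\<not> E a e"
    | "E a b" "E a e" "\<not> E a c" "\<not> E a d" | "E a c" "E a d" "\<not> E a b" "\<not> E a e"
    | "E a c" "E a e" "\<not> E a b" "\<not> E a d" | "E a d" "E a e" "\<not> E a b" "\<not> E a c"
    by argo
  then show thesis
  proof cases
    case 1 then show thesis by (intro nbrs[of a b d e c]) (use dist V in auto)
  next
    case 2 then show thesis by (intro nbrs[of a b c e d]) (use dist V in auto)
  next
    case 3 then show thesis by (intro nbrs[of a b c d e]) (use dist V in auto)
  next
    case 4 then show thesis by (intro nbrs[of a c b e d]) (use dist V in auto)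
  next
    case 5 then show thesis by (intro nbrs[of a c b d e]) (use dist V in auto)
  next
    case 6 then show thesis by (intro nbrs[of a d b c e]) (use dist V in auto)
  qed
qed

text \<open>Since \<open>apq\<close> is red, \<open>b\<close>, \<open>c\<close>, \<open>r\<close>,
  \<open>s\<close>, \<open>t\<close> carry a red pentagon with the path \<open>rst\<close> and the
  edge \<open>bc\<close>. It closes up through \<open>br\<close>, \<open>ct\<close> or through
  \<open>bt\<close>, \<open>cr\<close>.\<close>

lemma no_red_triangle_on_cycle_edge:
  assumes dist: "distinct [a, b, c, p, q, r, s, t]" and V: "{a, b, c, p, q, r, s, t} \<subseteq> V"
    and abc: "E a b" "E a c" "E b c"
    and cycle: "E p q" "E q r" "E r s" "E s t" "E t p"
      "\<not> E p r" "\<not> E q s" "\<not> E r t" "\<not> E s p" "\<not> E t q"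
    and a: "E a p" "E a q"
  shows False
proof -
  \<comment> \<open>A third triangle leaves a star: if \<open>bq\<close> is red, \<open>bqr\<close>
    leaves \<open>t\<close> red to \<open>p\<close>, \<open>s\<close>, \<open>c\<close>; otherwise
    the blue \<open>bqs\<close> leaves \<open>r\<close> blue to \<open>c\<close>, \<open>p\<close>,
    \<open>t\<close>.\<close>
  have one: False
    if dist: "distinct [a, b, c, p, q, r, s, t]" and V: "{a, b, c, p, q, r, s, t} \<subseteq> V"
      and abc: "E a b" "E a c" "E b c" and bc: "E b r" "E c t" "\<not> E c r" "\<not> E b s" for b c
  proof (cases "E b q")
    case True
    have "mono3 E b q r"
      using True bc cycle by (simp add: mono3_def)
    from no_star[OF this, of t p s c] show False
      using dist V cycle bc sym[of t s] sym[of t c] by auto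
  next
    case False
    have "mono3 E b q s"
      using False bc cycle by (simp add: mono3_def)
    from no_star[OF this, of r c p t] show False
      using dist V cycle bc sym[of r c] sym[of r p] by auto
  qed
  have mono: "mono3 E a p q"
    using cycle a by (simp add: mono3_def)
  have "\<not> mono3 E b c r" "\<not> mono3 E b c t" "\<not> (E s r = E s t \<and> E s t = E s b)"
    "\<not> (E s r = E s t \<and> E s t = E s c)" "\<not> (E b r = E b s \<and> E b s = E b t)"
    "\<not> (E c r = E c s \<and> E c s = E c t)"
    by (rule not_two[OF mono] no_star[OF mono]; use dist V in auto)+
  moreover have "E s r = E r s" "E s b = E b s" "E s c = E c s"
    by (rule sym)+
  ultimately consider "E b r" "E c t" "\<not> E c r" "\<not> E b s" | "E c r" "E b t" "\<not> E b r" "\<not> E c s"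
    using abc cycle unfolding mono3_def by argo
  then show False
  proof cases
    case 1
    show False by (rule one[OF dist V abc 1])
  next
    case 2
    show False by (rule one[of c b]) (use dist V abc 2 sym[of c b] in auto)
  qed
qed

lemma no_red_triangle:
  assumes dist: "distinct [a, b, c, u, v, w, x, y]" and V: "{a, b, c, u, v, w, x, y} \<subseteq> V"
    and abc: "E a b" "E a c" "E b c"
  shows False
proof -
  have mono: "mono3 E a b c"
    using abc by (simp add: mono3_def)
  have edge: "\<not> (E a p \<and> E a q) \<and> (E a p \<or> E a r)"
    if P: "distinct [a, b, c, p, q, r, s, t]" "{a, b, c, p, q, r, s, t} \<subseteq> V"
      and cycle: "E p q" "E q r" "E r s" "E s t" "E t p"
        "\<not> E p r" "\<not> E q s" "\<not> E r t" "\<not> E s p" "\<not> E t q" for p q r s t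
  proof (intro conjI notI)
    assume "E a p \<and> E a q"
    then show False
      using no_red_triangle_on_cycle_edge[OF P abc cycle] by blast
  next
    show "E a p \<or> E a r"
    proof (rule ccontr)
      assume "\<not> (E a p \<or> E a r)"
      \<comment> \<open>Outside this blue triangle, \<open>q\<close> is blue to \<open>s\<close> and
        \<open>t\<close>, hence red to \<open>b\<close> and \<open>c\<close>; so \<open>bcq\<close>
        is red and disjoint from \<open>apr\<close>.\<close>
      then have mono: "mono3 E a p r"
        using cycle by (simp add: mono3_def)
      have "\<not> mono3 E b c q" "\<not> (E q s = E q t \<and> E q t = E q b)"
        "\<not> (E q s = E q t \<and> E q t = E q c)"
        by (rule not_two[OF mono] no_star[OF mono]; use P in auto)+
      moreover have "E q t = E t q" "E q b = E b q" "E q c = E c q"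
        by (rule sym)+
      ultimately show False
        using abc cycle unfolding mono3_def by argo
    qed
  qed
  obtain p q r s t where P: "distinct [a, b, c, p, q, r, s, t]" "{a, b, c, p, q, r, s, t} \<subseteq> V"
    and cycle: "E p q" "E q r" "E r s" "E s t" "E t p"
      "\<not> E p r" "\<not> E q s" "\<not> E r t" "\<not> E s p" "\<not> E t q"
    using pentagon[OF mono dist V] by metis
  \<comment> \<open>The five rotations reach every edge and every diagonal of the pentagon; any
    three of its vertices contain one of each.\<close>
  have "\<not> (E a p \<and> E a q) \<and> (E a p \<or> E a r)"
    by (rule edge[OF P cycle])
  moreover have "\<not> (E a q \<and> E a r) \<and> (E a q \<or> E a s)"
    by (rule edge[of q r s t p]) (use P cycle in auto)
  moreover have "\<not> (E a r \<and> E a s) \<and> (E a r \<or> E a t)"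
    by (rule edge[of r s t p q]) (use P cycle in auto)
  moreover have "\<not> (E a s \<and> E a t) \<and> (E a s \<or> E a p)"
    by (rule edge[of s t p q r]) (use P cycle in auto)
  moreover have "\<not> (E a t \<and> E a p) \<and> (E a t \<or> E a q)"
    by (rule edge[of t p q r s]) (use P cycle in auto)
  ultimately show False by argo
qed

end

lemma two_disjoint_mono_triangles:
  assumes "card V \<ge> 8"
  obtains S T where "mono_triangle V c S" "mono_triangle V c T" "disjnt S T"
proof (rule ccontr)
  assume "\<not> thesis"
  with that have none: "\<not> disjnt S T" if "mono_triangle V c S" "mono_triangle V c T" for S T
    using that by blast
  have fin: "finite V" using assms by (metis card.infinite not_numeral_le_zero)
  have "card V \<ge> 6" using assms by simp
  then obtain T where T: "mono_triangle V c T" by (rule obtain_mono_triangle)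
  then obtain x y z where xyz: "T = {x, y, z}" "distinct [x, y, z]"
    using mono_triangleD(3)[OF T] by (auto simp: card_3_iff)
  \<comment> \<open>Taking the colour of \<open>T\<close> as red treats both colours at
    once.\<close>
  define E where "E u v \<longleftrightarrow> c {u, v} = c {x, y}" for u v
  have E_eq: "E u v = E u' v' \<longleftrightarrow> c {u, v} = c {u', v'}" for u v u' v'
    unfolding E_def by (rule colour_eq_iff[symmetric])
  interpret no_two_disjoint_mono V E
  proof
    show "E u v \<longleftrightarrow> E v u" for u v by (simp add: E_def insert_commute)
  next
    fix x y z u v w
    assume *: "mono3 E x y z" "distinct [x, y, z, u, v, w]" "{x, y, z, u, v, w} \<subseteq> V"
    show "\<not> mono3 E u v w"
    proof
      assume "mono3 E u v w"
      with * have "mono_triangle V c {x, y, z}" "mono_triangle V c {u, v, w}"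
        unfolding mono3_def E_eq by (simp_all add: mono_triangle_triple)
      moreover have "disjnt {x, y, z} {u, v, w}"
        using *(2) by auto
      ultimately show False using none by blast
    qed
  qed
  have "card (V - T) \<ge> 5"
    using assms fin mono_triangleD[OF T] by (simp add: card_Diff_subset)
  then obtain A where A: "A \<subseteq> V - T" "card A = 5" by (metis obtain_subset_with_card_n)
  then have "finite A" using fin finite_subset by blast
  then obtain as where as: "set as = A" "distinct as" "length as = 5"
    using A(2) finite_distinct_list distinct_card by metis
  then obtain p q r s t where "as = [p, q, r, s, t]"
    by (auto simp: length_Suc_conv numeral_eq_Suc)
  with as A xyz have "distinct [x, y, z, p, q, r, s, t]" "{x, y, z, p, q, r, s, t} \<subseteq> V"
    using mono_triangleD(1)[OF T] by auto
  moreover have "E x y" "E x z" "E y z"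
    using T xyz by (auto simp: E_def mono_triangle_triple)
  ultimately show False by (rule no_red_triangle)
qed

section \<open>Packings of monochromatic triangles\<close>

text \<open>The induction starts at \<open>k = 2\<close>, on eight vertices: for
  \<open>k = 1\<close> the pentagon colouring of five vertices is a counterexample.\<close>

lemma obtain_disjoint_mono_family:
  assumes "2 \<le> k" "3 * k + 2 \<le> card V"
  obtains F where "F \<in> disjoint_mono_families V c" "card F = k"
  using assms
proof (induction k arbitrary: V thesis rule: dec_induct)
  case base
  then obtain S T where "mono_triangle V c S" "mono_triangle V c T" "disjnt S T"
    using two_disjoint_mono_triangles[of V c] by auto
  moreover from this have "S \<noteq> T"
    using mono_triangleD(4) by fastforce
  ultimately show ?case
    by (intro base(1)[of "{S, T}"])
      (auto simp: disjoint_mono_families_def pairwise_insert disjnt_sym)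
next
  case (step k)
  have fin: "finite V" using step.prems(2) by (metis card.infinite add_is_0 le_zero_eq zero_neq_numeral)
  have "card V \<ge> 6" using step.hyps step.prems(2) by simp
  then obtain T where T: "mono_triangle V c T" by (rule obtain_mono_triangle)
  have "3 * k + 2 \<le> card (V - T)"
    using step.prems fin mono_triangleD[OF T] by (simp add: card_Diff_subset)
  then obtain F where F: "F \<in> disjoint_mono_families (V - T) c" "card F = k"
    using step.IH by blast
  have "T \<notin> F" and disj: "\<And>S. S \<in> F \<Longrightarrow> disjnt S T"
    using F(1) mono_triangleD[OF T] mono_triangleD(1)
    by (fastforce simp: disjoint_mono_families_def disjnt_def)+
  moreover have "finite F"
    using F(2) step.hyps by (metis card.infinite not_numeral_le_zero)
  ultimately show ?case
    using F T mono_triangle_mono[of "V - T" c _ V]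
    by (intro step.prems(1)[of "insert T F"])
      (auto simp: disjoint_mono_families_def pairwise_insert disjnt_sym)
qed

lemma obtain_large_disjoint_mono_family:
  assumes "card V \<noteq> 5"
  obtains F where "F \<in> disjoint_mono_families V c" "card F = (card V - 2) div 3"
proof -
  \<comment> \<open>The quotient is 0 below five, by truncated subtraction also for 0 and 1, and it
    is 1 at six and seven.\<close>
  consider "card V < 5" | "card V = 6 \<or> card V = 7" | "card V \<ge> 8"
    using assms by linarith
  then show thesis
  proof cases
    case 1
    then show thesis
      by (intro that[of "{}"]) (auto simp: disjoint_mono_families_def)
  next
    case 2
    then have "card V \<ge> 6" by auto
    then obtain T where "mono_triangle V c T" by (rule obtain_mono_triangle)
    with 2 show thesis
      by (intro that[of "{T}"]) (auto simp: disjoint_mono_families_def)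
  next
    case 3
    then have "2 \<le> (card V - 2) div 3" "3 * ((card V - 2) div 3) + 2 \<le> card V"
      by linarith+
    then show thesis
      by (rule obtain_disjoint_mono_family) (rule that)
  qed
qed

lemma card_disjoint_family_le:
  assumes "pairwise disjnt F" "\<And>T. T \<in> F \<Longrightarrow> T \<subseteq> A \<and> card T = k" "finite A" "k > 0"
  shows "card F \<le> card A div k"
proof -
  have "card F * k = (\<Sum>T\<in>F. card T)" using assms(2) by simp
  also have "\<dots> = card (\<Union>F)"
    using assms by (intro card_Union_disjoint[symmetric]) (auto intro: finite_subset)
  also have "\<dots> \<le> card A"
    using assms by (intro card_mono) auto
  finally show ?thesis
    using \<open>k > 0\<close> by (simp add: less_eq_div_iff_mult_less_eq)
qed

text \<open>
  Make the edges between a pair \<open>B\<close> and the other vertices blue and the rest red: the blue graph is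
  bipartite and \<open>B\<close> is a red component, so every monochromatic triangle avoids \<open>B\<close>.
\<close>

lemma exists_colouring_few_triangles:
  assumes "finite V" "card V \<ge> 2"
  obtains c where "c \<in> colourings V"
    "\<And>F. F \<in> disjoint_mono_families V c \<Longrightarrow> card F \<le> (card V - 2) div 3"
proof -
  obtain B where B: "B \<subseteq> V" "card B = 2" using assms(2) by (metis obtain_subset_with_card_n)
  then obtain u v where uv: "B = {u, v}" "u \<noteq> v" by (meson card_2_iff)
  define c where
    "c = (\<lambda>e\<in>nsets V 2. if e \<subseteq> B \<or> e \<inter> B = {} then Red else Blue)"
  have "c \<in> colourings V"
    by (simp add: c_def colourings_def)
  moreover have T: "T \<subseteq> V - B \<and> card T = 3" if mono: "mono_triangle V c T" for T
  proof -
    obtain x y z where xyz: "T = {x, y, z}" "distinct [x, y, z]"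
      using mono_triangleD(3)[OF mono] by (auto simp: card_3_iff)
    have "{x, y} \<in> nsets V 2" "{x, z} \<in> nsets V 2" "{y, z} \<in> nsets V 2"
      using xyz mono_triangleD(1)[OF mono] by (auto simp: nsets_def)
    moreover have "c {x, y} = c {x, z}" "c {x, z} = c {y, z}"
      using mono xyz by (auto simp: mono_triangle_triple)
    \<comment> \<open>A triangle meeting \<open>B\<close> has two blue edges and one red edge, which
      lies inside \<open>B\<close> or opposite its only vertex in \<open>B\<close>.\<close>
    ultimately have "T \<inter> B = {}"
      using xyz uv by (auto simp: c_def split: if_splits)
    then show ?thesis using mono_triangleD[OF mono] by blast
  qed
  moreover have "card (V - B) = card V - 2"
    using B assms(1) by (metis card_Diff_subset finite_subset)
  ultimately show thesis
    using that[of c] card_disjoint_family_le[of _ "V - B" 3] assms(1)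
    by (auto simp: disjoint_mono_families_def)
qed

text \<open>For \<open>n = 5\<close> the pentagon colouring has no monochromatic triangle although
  the floor is 1; for \<open>n < 2\<close> the floor is -1.\<close>

theorem corollary3p8:
  fixes V :: "'a set" and n :: nat
  assumes "finite V" and "card V = n" and "n \<ge> 2" and "n \<noteq> 5"
  shows "int (min_disjoint_mono V) = \<lfloor>(of_nat n - 2) / 3 :: rat\<rfloor>"
proof -
  note fin = finite_disjoint_mono_families[OF assms(1)] finite_colourings[OF assms(1)]
  have "(n - 2) div 3 \<le> max_disjoint_mono V c" for c
  proof -
    obtain F where "F \<in> disjoint_mono_families V c" "card F = (n - 2) div 3"
      using obtain_large_disjoint_mono_family[of V c] assms by auto
    then show ?thesis
      unfolding max_disjoint_mono_def using fin(1) by (metis Max_ge finite_imageI imageI)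
  qed
  then have "(n - 2) div 3 \<le> min_disjoint_mono V"
    unfolding min_disjoint_mono_def using fin(2) colourings_nonempty by (subst Min_ge_iff) auto
  moreover obtain c where c: "c \<in> colourings V"
    "\<And>F. F \<in> disjoint_mono_families V c \<Longrightarrow> card F \<le> (n - 2) div 3"
    using exists_colouring_few_triangles[of V] assms by auto
  then have "max_disjoint_mono V c \<le> (n - 2) div 3"
    unfolding max_disjoint_mono_def using fin(1) disjoint_mono_families_nonempty
    by (subst Max_le_iff) auto
  then have "min_disjoint_mono V \<le> (n - 2) div 3"
    unfolding min_disjoint_mono_def using fin(2) c(1)
    by (metis Min_le finite_imageI imageI order_trans)
  ultimately have "min_disjoint_mono V = (n - 2) div 3" by simp
  \<comment> \<open>As \<open>n \<ge> 2\<close>, the natural subtraction does not truncate.\<close>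
  moreover have "\<lfloor>(of_nat n - 2) / 3 :: rat\<rfloor> = int ((n - 2) div 3)"
    using floor_divide_of_nat_eq[of "n - 2" 3, where ?'a = rat] assms(3) by (simp add: of_nat_diff)
  ultimately show ?thesis by simp
qed

end
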